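(* Let $\mathcal X=\{x\in\mathbb R^N:\|x\|_\infty\le1\}$ (and $\mathcal F$ the unit $\ell_1$ ball of $\mathbb R^N$, with loss $\ell(f,x)=\langle f,x\rangle$). Let $D$ be the uniform distribution on the vertices $\{\pm1\}^N$ of the cube and let $C=6$. Then for every $t\in\{1,\dots,T\}$, all $x_1,\dots,x_{t-1},x_{t+1},\dots,x_T\in\mathcal X$ and all $\epsilon_{t+1},\dots,\epsilon_T\in\{\pm1\}$, $$\sup_{p\in\Delta(\mathcal X)}\mathbb E_{x_t\sim p}\Big\|C\sum_{i=t+1}^T\epsilon_ix_i-\sum_{i=1}^{t-1}x_i+\mathbb E_{x\sim p}[x]-x_t\Big\|_\infty\le\mathbb E_{\epsilon_t,\,x_t\sim D}\Big\|C\sum_{i=t}^T\epsilon_ix_i-\sum_{i=1}^{t-1}x_i\Big\|_\infty .$$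
   Context: $\Delta(\mathcal X)$ is the set of probability distributions on $\mathcal X$. On the right-hand side $\epsilon_t$ is a Rademacher (uniform $\pm1$) random variable independent of $x_t\sim D$. *)

theory Defs
  imports "HOL-Probability.Probability"
begin

definition linf_ball :: "(real ^ 'n) set" where
  "linf_ball = {x. infnorm x \<le> 1}"

definition cube_vertices :: "(real ^ 'n) set" where
  "cube_vertices = {x. \<forall>i. x $ i \<in> {-1, 1}}"

text \<open>Borel probability measures on \<open>X\<close>; the underlying space of such a measure is \<open>X\<close> itself.\<close>

definition prob_distributions :: "'a::topological_space set \<Rightarrow> 'a measure set" where
  "prob_distributions X = {p. prob_space p \<and> sets p = sets (restrict_space borel X)}"

definition rademacher_pmf :: "real pmf" where
  "rademacher_pmf = pmf_of_set {-1, 1}"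

definition uniform_vertices_pmf :: "(real ^ 'n) pmf" where
  "uniform_vertices_pmf = pmf_of_set cube_vertices"

text \<open>\<^const>\<open>pmf_of_set\<close> is unspecified unless its argument is finite and nonempty.\<close>

lemma finite_cube_vertices: "finite (cube_vertices :: (real ^ 'n) set)"
proof -
  have "finite {f :: 'n \<Rightarrow> real. \<forall>i. f i \<in> {-1, 1}}"
    using finite_PiE[of "UNIV :: 'n set" "\<lambda>_. {-1, 1 :: real}"]
    by (simp add: PiE_def Pi_def extensional_def)
  then have "finite (vec_lambda ` {f :: 'n \<Rightarrow> real. \<forall>i. f i \<in> {-1, 1}})"
    by (rule finite_imageI)
  moreover have "(cube_vertices :: (real ^ 'n) set) \<subseteq> vec_lambda ` {f. \<forall>i. f i \<in> {-1, 1}}"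
  proof
    fix x :: "real ^ 'n"
    assume "x \<in> cube_vertices"
    then have "vec_nth x \<in> {f. \<forall>i. f i \<in> {-1, 1}}"
      by (simp add: cube_vertices_def)
    then have "vec_lambda (vec_nth x) \<in> vec_lambda ` {f. \<forall>i. f i \<in> {-1, 1}}"
      by (rule imageI)
    then show "x \<in> vec_lambda ` {f. \<forall>i. f i \<in> {-1, 1}}"
      by simp
  qed
  ultimately show ?thesis
    by (rule rev_finite_subset)
qed

lemma cube_vertices_nonempty: "(cube_vertices :: (real ^ 'n) set) \<noteq> {}"
proof -
  have "(\<chi> i. 1) \<in> (cube_vertices :: (real ^ 'n) set)"
    by (simp add: cube_vertices_def)
  then show ?thesis by blast
qed

end

theory Submission
  imports Defs
begin

text \<open>
  Both sides depend on the data only through \<open>w = C (\<Sum>i>t. \<epsilon>\<^sub>i x\<^sub>i) - (\<Sum>i<t. x\<^sub>i)\<close>, and \<open>\<epsilon>\<^sub>t x\<^sub>t\<close> is again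
  uniform on the vertices. Let \<open>M = \<bar>w\<^sub>i\<bar>\<close> be the norm of \<open>w\<close>. If another coordinate satisfies
  \<open>\<bar>w\<^sub>j\<bar> \<ge> M - 4\<close>, then the left-hand side is trivially at most \<open>M + 2\<close>; on the right, at least one
  of the two coordinates moves outwards with probability 3/4, which gives at least
  \<open>(M + 6)/2 + (M + 2)/4 + (M - 6)/4 = M + 2\<close>, and this is where the constant 6 comes from.
  Otherwise, unless \<open>M < 2\<close>, the coordinate \<open>i\<close> dominates on the left whatever the
  (centred) perturbation is, so the left-hand side is exactly \<open>M\<close>. The right-hand side is always at
  least \<open>max M 6\<close>.
\<close>

lemma infnorm_le_iff_cart: "infnorm (x :: real ^ 'n) \<le> c \<longleftrightarrow> (\<forall>i. \<bar>x $ i\<bar> \<le> c)"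
proof
  assume "infnorm x \<le> c"
  then show "\<forall>i. \<bar>x $ i\<bar> \<le> c"
    using component_le_infnorm_cart order_trans by blast
next
  assume "\<forall>i. \<bar>x $ i\<bar> \<le> c"
  then show "infnorm x \<le> c"
    unfolding infnorm_cart by (intro cSup_least) auto
qed

lemma infnorm_attained_cart:
  obtains i where "infnorm (x :: real ^ 'n) = \<bar>x $ i\<bar>"
proof -
  have "infnorm x = Max (range (\<lambda>i. \<bar>x $ i\<bar>))"
    unfolding infnorm_cart by (simp add: full_SetCompr_eq cSup_eq_Max)
  also have "\<dots> \<in> range (\<lambda>i. \<bar>x $ i\<bar>)"
    by (intro Max_in) auto
  finally show thesis using that by auto
qed

lemma set_pmf_uniform_vertices: "set_pmf (uniform_vertices_pmf :: (real ^ 'n) pmf) = cube_vertices"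
  unfolding uniform_vertices_pmf_def
  by (intro set_pmf_of_set finite_cube_vertices cube_vertices_nonempty)

lemma integrable_uniform_vertices:
  fixes h :: "real ^ 'n \<Rightarrow> real"
  shows "integrable (measure_pmf uniform_vertices_pmf) h"
  by (rule integrable_measure_pmf_finite)
    (simp add: set_pmf_uniform_vertices finite_cube_vertices)

lemma cube_vertices_nth: "x \<in> cube_vertices \<Longrightarrow> x $ i = 1 \<or> x $ i = -1"
  by (auto simp: cube_vertices_def)

text \<open>Changing the sign of one coordinate is an involution of the vertices, so it preserves
  the uniform distribution. The moments needed later follow: single coordinates and products of two
  distinct ones have mean zero.\<close>

lemma expectation_uniform_vertices_odd:
  fixes h :: "real ^ 'n \<Rightarrow> real"
  assumes odd: "\<And>x. h (\<chi> k. if k = i then - x $ k else x $ k) = - h x"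
  shows "measure_pmf.expectation uniform_vertices_pmf h = 0"
proof -
  define flip where "flip = (\<lambda>x :: real ^ 'n. \<chi> k. if k = i then - x $ k else x $ k)"
  have inv: "flip (flip x) = x" for x
    by (simp add: flip_def vec_eq_iff)
  have mem: "flip x \<in> cube_vertices" if "x \<in> cube_vertices" for x
    using that by (fastforce simp: flip_def cube_vertices_def)
  have "bij_betw flip cube_vertices cube_vertices"
    by (rule bij_betw_byWitness[where f' = flip]) (auto simp: inv mem)
  then have "map_pmf flip uniform_vertices_pmf = uniform_vertices_pmf"
    unfolding uniform_vertices_pmf_def
    by (rule map_pmf_of_set_bij_betw) (simp_all add: finite_cube_vertices cube_vertices_nonempty)
  then have "measure_pmf.expectation uniform_vertices_pmf h
      = measure_pmf.expectation (map_pmf flip uniform_vertices_pmf) h"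
    by simp
  also have "\<dots> = - measure_pmf.expectation uniform_vertices_pmf h"
    using odd by (simp add: integral_map_pmf flip_def)
  finally show ?thesis by simp
qed

lemma expectation_uniform_vertices_nth:
  "measure_pmf.expectation uniform_vertices_pmf (\<lambda>x :: real ^ 'n. x $ i) = 0"
  by (rule expectation_uniform_vertices_odd[where i = i]) simp

lemma expectation_uniform_vertices_nth_mult:
  assumes "i \<noteq> j"
  shows "measure_pmf.expectation uniform_vertices_pmf (\<lambda>x :: real ^ 'n. x $ i * x $ j) = 0"
  by (rule expectation_uniform_vertices_odd[where i = i]) (use assms in simp)

text \<open>For each fixed sign \<open>e\<close>, scaling by \<open>e\<close> permutes the vertices,
  so the product has the law of a uniform vertex whatever \<open>e\<close> is. This removes the
  Rademacher variable from the right-hand side of the theorem.\<close>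

lemma expectation_rademacher_times_vertices:
  fixes F :: "real ^ 'n \<Rightarrow> real"
  shows "measure_pmf.expectation (pair_pmf rademacher_pmf uniform_vertices_pmf) (\<lambda>(e, x). F (e *\<^sub>R x))
    = measure_pmf.expectation uniform_vertices_pmf F"
proof -
  have map: "map_pmf ((*\<^sub>R) e) uniform_vertices_pmf = (uniform_vertices_pmf :: (real ^ 'n) pmf)"
    if "e \<in> set_pmf rademacher_pmf" for e
  proof -
    from that have e: "e = 1 \<or> e = -1"
      by (simp add: rademacher_pmf_def disj_commute)
    have "bij_betw ((*\<^sub>R) e) cube_vertices (cube_vertices :: (real ^ 'n) set)"
      by (rule bij_betw_byWitness[where f' = "(*\<^sub>R) e"])
        (use e in \<open>fastforce simp: cube_vertices_def\<close>)+
    then show ?thesis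
      unfolding uniform_vertices_pmf_def
      by (rule map_pmf_of_set_bij_betw) (simp_all add: finite_cube_vertices cube_vertices_nonempty)
  qed
  have "map_pmf (\<lambda>(e, x). e *\<^sub>R x) (pair_pmf rademacher_pmf uniform_vertices_pmf)
      = bind_pmf rademacher_pmf (\<lambda>e. map_pmf ((*\<^sub>R) e) (uniform_vertices_pmf :: (real ^ 'n) pmf))"
    by (simp add: pair_pmf_def map_bind_pmf map_pmf_def bind_assoc_pmf bind_return_pmf)
  also have "\<dots> = bind_pmf rademacher_pmf (\<lambda>e. uniform_vertices_pmf)"
    by (intro bind_pmf_cong refl map)
  finally have "map_pmf (\<lambda>(e, x). e *\<^sub>R x) (pair_pmf rademacher_pmf uniform_vertices_pmf)
      = (uniform_vertices_pmf :: (real ^ 'n) pmf)"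
    by (simp add: bind_pmf_const)
  then have "measure_pmf.expectation uniform_vertices_pmf F
      = measure_pmf.expectation
          (map_pmf (\<lambda>(e, x). e *\<^sub>R x) (pair_pmf rademacher_pmf uniform_vertices_pmf)) F"
    by simp
  then show ?thesis
    by (simp add: integral_map_pmf case_prod_unfold)
qed

lemma expectation_infnorm_vertices_ge:
  fixes w :: "real ^ 'n"
  assumes "0 \<le> c"
  shows "infnorm w \<le> measure_pmf.expectation uniform_vertices_pmf (\<lambda>x. infnorm (w + c *\<^sub>R x))"
    and "c \<le> measure_pmf.expectation uniform_vertices_pmf (\<lambda>x. infnorm (w + c *\<^sub>R x))"
proof -
  obtain i where i: "infnorm w = \<bar>w $ i\<bar>"
    by (rule infnorm_attained_cart)
  have coord: "\<bar>w $ i + c * x $ i\<bar> \<le> infnorm (w + c *\<^sub>R x)" for x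
    using component_le_infnorm_cart[of "w + c *\<^sub>R x" i] by simp
  \<comment> \<open>It suffices to minorise one coordinate of the norm by an affine function of
    \<open>x $ i\<close>: its linear part averages out and the constant \<open>a\<close>
    remains.\<close>
  have avg: "a \<le> measure_pmf.expectation uniform_vertices_pmf (\<lambda>x. infnorm (w + c *\<^sub>R x))"
    if *: "\<And>x :: real ^ 'n. x \<in> cube_vertices \<Longrightarrow> a + b * x $ i \<le> \<bar>w $ i + c * x $ i\<bar>" for a b
  proof -
    have "a = measure_pmf.expectation uniform_vertices_pmf (\<lambda>x :: real ^ 'n. a + b * x $ i)"
      by (simp add: integrable_uniform_vertices expectation_uniform_vertices_nth)
    also have "\<dots> \<le> measure_pmf.expectation uniform_vertices_pmf (\<lambda>x. infnorm (w + c *\<^sub>R x))"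
      by (intro integral_mono_AE integrable_uniform_vertices)
        (auto simp: AE_measure_pmf_iff set_pmf_uniform_vertices intro!: order_trans[OF * coord])
    finally show ?thesis .
  qed
  show "infnorm w \<le> measure_pmf.expectation uniform_vertices_pmf (\<lambda>x. infnorm (w + c *\<^sub>R x))"
    by (rule avg[where b = "if w $ i \<ge> 0 then c else - c"])
      (use i in auto)
  \<comment> \<open>Since \<open>x $ i\<close> is 1 or -1, \<open>c + w $ i * x $ i\<close> equals
    \<open>x $ i * (w $ i + c * x $ i)\<close>, which is at most the absolute value of the second
    factor.\<close>
  show "c \<le> measure_pmf.expectation uniform_vertices_pmf (\<lambda>x. infnorm (w + c *\<^sub>R x))"
    by (rule avg[where b = "w $ i"]) (use cube_vertices_nth[of _ i] in fastforce)
qed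

text \<open>The norm is minorised by a function of two coordinates whose mean needs only the
  vanishing of the first moments and of the mixed moment.\<close>

lemma expectation_infnorm_vertices_ge_two_coordinates:
  fixes w :: "real ^ 'n"
  assumes i: "infnorm w = \<bar>w $ i\<bar>" and ij: "i \<noteq> j" and j: "\<bar>w $ i\<bar> - 4 \<le> \<bar>w $ j\<bar>"
  shows "infnorm w + 2 \<le> measure_pmf.expectation uniform_vertices_pmf (\<lambda>x. infnorm (w + 6 *\<^sub>R x))"
proof -
  define s where "s k = (if w $ k \<ge> 0 then 1 else -1 :: real)" for k
  txt \<open>The bilinear function of \<open>(s i * x $ i, s j * x $ j)\<close> with the values 6, 6, 2, -6 at
    (1, 1), (1, -1), (-1, 1), (-1, -1).\<close>
  define g where "g x = infnorm w + 2 + 4 * s i * x $ i + 2 * s j * x $ j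
      - 2 * s i * s j * (x $ i * x $ j)" for x :: "real ^ 'n"
  have "infnorm w + 2 = measure_pmf.expectation uniform_vertices_pmf g"
    unfolding g_def
    by (simp add: integrable_uniform_vertices expectation_uniform_vertices_nth
        expectation_uniform_vertices_nth_mult ij)
  also have "\<dots> \<le> measure_pmf.expectation uniform_vertices_pmf (\<lambda>x. infnorm (w + 6 *\<^sub>R x))"
  proof (intro integral_mono_AE integrable_uniform_vertices)
    \<comment> \<open>If \<open>i\<close> moves outwards, it reaches \<open>infnorm w + 6\<close>.
      If only \<open>j\<close> does, it reaches at least \<open>infnorm w + 2\<close>, because it
      starts at most 4 lower. If neither does, coordinate \<open>i\<close> still has absolute value
      at least \<open>infnorm w - 6\<close>.\<close>
    have "g x \<le> infnorm (w + 6 *\<^sub>R x)" if x: "x \<in> cube_vertices" for x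
    proof -
      have "\<bar>w $ i + 6 * x $ i\<bar> \<le> infnorm (w + 6 *\<^sub>R x)" "\<bar>w $ j + 6 * x $ j\<bar> \<le> infnorm (w + 6 *\<^sub>R x)"
        using component_le_infnorm_cart[of "w + 6 *\<^sub>R x"] by simp_all
      then show ?thesis
        using cube_vertices_nth[OF x, of i] cube_vertices_nth[OF x, of j] i j
        by (auto simp: g_def s_def)
    qed
    then show "AE x in measure_pmf uniform_vertices_pmf. g x \<le> infnorm (w + 6 *\<^sub>R x)"
      by (simp add: AE_measure_pmf_iff set_pmf_uniform_vertices)
  qed
  finally show ?thesis .
qed

text \<open>This is the inequality for a single \<open>p\<close>, with the current round on the
  right already reduced to one uniform vertex.\<close>

lemma integral_infnorm_centred_le:
  fixes w :: "real ^ 'n"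
  assumes p: "p \<in> prob_distributions linf_ball"
  shows "(\<integral>y. infnorm (w + (\<integral>z. z \<partial>p) - y) \<partial>p)
    \<le> measure_pmf.expectation uniform_vertices_pmf (\<lambda>x. infnorm (w + 6 *\<^sub>R x))"
    (is "?L \<le> ?R")
proof -
  interpret prob_space p
    using p by (simp add: prob_distributions_def)
  have sets: "sets p = sets (restrict_space borel linf_ball)"
    using p by (simp add: prob_distributions_def)
  have space: "space p = linf_ball"
    using sets_eq_imp_space_eq[OF sets] by (simp add: space_restrict_space)
  have meas: "f \<in> borel_measurable p" if "continuous_on UNIV f"
    for f :: "real ^ 'n \<Rightarrow> 'b :: topological_space"
    unfolding measurable_cong_sets[OF sets refl]
    by (intro measurable_restrict_space1 borel_measurable_continuous_onI that)
  have bound: "\<bar>y $ k\<bar> \<le> 1" if "y \<in> space p" for y k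
    using that infnorm_le_iff_cart by (auto simp: space linf_ball_def)
  have int_nth: "integrable p (\<lambda>y. y $ k)" for k
    by (rule integrable_const_bound[where B = 1])
      (auto intro!: AE_I2 bound meas continuous_intros)
  \<comment> \<open>Without integrability the vector-valued integral would be 0 by default; with it,
    the coordinates of \<open>m\<close> are the means of the coordinates. The bound comes from
    comparing the Euclidean norm with the l1 norm.\<close>
  have int_id: "integrable p (\<lambda>y. y)"
  proof (rule integrable_const_bound[where B = "real CARD('n)"])
    have "norm y \<le> real CARD('n)" if "y \<in> space p" for y
    proof -
      have "(\<Sum>k\<in>UNIV. \<bar>y $ k\<bar>) \<le> (\<Sum>k\<in>(UNIV :: 'n set). 1)"
        by (intro sum_mono bound that)
      then show ?thesis
        using norm_le_l1_cart[of y] by simp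
    qed
    then show "AE y in p. norm y \<le> real CARD('n)" by simp
  qed (intro meas continuous_intros)
  define m where "m = (\<integral>z. z \<partial>p)"
  have m_nth: "(\<integral>y. y $ k \<partial>p) = m $ k" for k
    unfolding m_def by (rule integral_bounded_linear[OF bounded_linear_vec_nth int_id])
  have m_bound: "\<bar>m $ k\<bar> \<le> 1" for k
  proof -
    have "\<bar>m $ k\<bar> \<le> (\<integral>y. \<bar>y $ k\<bar> \<partial>p)"
      unfolding m_nth[symmetric] by (rule integral_abs_bound)
    also have "\<dots> \<le> 1"
      by (intro integral_le_const integrable_abs int_nth AE_I2 bound)
    finally show ?thesis .
  qed
  have diff: "\<bar>m $ k - y $ k\<bar> \<le> 2" if "y \<in> space p" for y k
    using m_bound[of k] bound[OF that, of k] by linarith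
  obtain i where i: "infnorm w = \<bar>w $ i\<bar>"
    by (rule infnorm_attained_cart)
  have upper: "infnorm (w + m - y) \<le> infnorm w + 2" if "y \<in> space p" for y
    unfolding infnorm_le_iff_cart
  proof
    fix k
    show "\<bar>(w + m - y) $ k\<bar> \<le> infnorm w + 2"
      using diff[OF that, of k] component_le_infnorm_cart[of w k] by (simp add: algebra_simps)
  qed
  have int_infnorm: "integrable p (\<lambda>y. infnorm (w + m - y))"
    by (rule integrable_const_bound[where B = "infnorm w + 2"])
      (auto intro!: AE_I2 upper meas continuous_intros continuous_on_infnorm simp: infnorm_pos_le)
  have L_upper: "?L \<le> infnorm w + 2"
    unfolding m_def[symmetric] by (intro integral_le_const int_infnorm AE_I2 upper)
  show ?thesis
  proof (cases "infnorm w < 2 \<or> (\<exists>j. j \<noteq> i \<and> \<bar>w $ i\<bar> - 4 \<le> \<bar>w $ j\<bar>)")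
    case True
    then show ?thesis
    proof
      \<comment> \<open>Here the left-hand side is below 4 and the right-hand side is at least
        6.\<close>
      assume "infnorm w < 2"
      then show ?thesis
        using L_upper expectation_infnorm_vertices_ge(2)[of 6 w] by simp
    next
      assume "\<exists>j. j \<noteq> i \<and> \<bar>w $ i\<bar> - 4 \<le> \<bar>w $ j\<bar>"
      then show ?thesis
        using L_upper expectation_infnorm_vertices_ge_two_coordinates[OF i] by force
    qed
  next
    case False
    define s where "s = sgn (w $ i)"
    have "infnorm (w + m - y) \<le> infnorm w + s * (m $ i - y $ i)" if y: "y \<in> space p" for y
      unfolding infnorm_le_iff_cart
    proof
      fix k
      \<comment> \<open>Now \<open>infnorm w\<close> is at least 2, so a perturbation of size at
        most 2 cannot carry coordinate \<open>i\<close> across 0, and its absolute value is affine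
        in \<open>y $ i\<close>.\<close>
      have s: "infnorm w + s * (m $ i - y $ i) = \<bar>w $ i + (m $ i - y $ i)\<bar>"
        using False i diff[OF y, of i] by (auto simp: s_def sgn_if)
      show "\<bar>(w + m - y) $ k\<bar> \<le> infnorm w + s * (m $ i - y $ i)"
      proof (cases "k = i")
        case True
        then show ?thesis unfolding s by (simp add: algebra_simps)
      next
        case neq: False
        \<comment> \<open>After perturbation coordinate \<open>k\<close> stays below
          \<open>infnorm w - 2\<close> in absolute value, while coordinate \<open>i\<close> never
          drops under that level.\<close>
        then have "\<bar>w $ k\<bar> < \<bar>w $ i\<bar> - 4"
          using False by force
        then show ?thesis
          using diff[OF y, of i] diff[OF y, of k] unfolding s by (simp add: algebra_simps)
      qed
    qed
    \<comment> \<open>The term added to \<open>infnorm w\<close> is centred, because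
      \<open>m\<close> is the mean of \<open>p\<close>, so it disappears on integration.\<close>
    then have "?L \<le> (\<integral>y. infnorm w + s * (m $ i - y $ i) \<partial>p)"
      unfolding m_def[symmetric]
      by (intro integral_mono int_infnorm) (simp_all add: int_nth)
    also have "\<dots> = infnorm w"
      by (simp add: int_nth m_nth prob_space)
    also have "\<dots> \<le> ?R"
      by (rule expectation_infnorm_vertices_ge) simp
    finally show ?thesis .
  qed
qed

theorem lemma12:
  fixes C :: real and t T :: nat
    and x :: "nat \<Rightarrow> real ^ 'n" and eps :: "nat \<Rightarrow> real"
  assumes "C = 6"
    and "t \<in> {1..T}"
    and "\<forall>i \<in> {1..T} - {t}. x i \<in> linf_ball"
    and "\<forall>i \<in> {t+1..T}. eps i \<in> {-1, 1}"
  shows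
    "(SUP p \<in> prob_distributions (linf_ball :: (real ^ 'n) set).
        ereal (\<integral>xt. infnorm (C *\<^sub>R (\<Sum>i=t+1..T. eps i *\<^sub>R x i) - (\<Sum>i=1..<t. x i)
                          + (\<integral>y. y \<partial>p) - xt) \<partial>p))
     \<le> ereal (measure_pmf.expectation (pair_pmf rademacher_pmf uniform_vertices_pmf)
          (\<lambda>(et, xt). infnorm (C *\<^sub>R (\<Sum>i=t..T. (eps(t := et)) i *\<^sub>R (x(t := xt)) i)
                              - (\<Sum>i=1..<t. x i))))"
proof -
  define w where "w = C *\<^sub>R (\<Sum>i=t+1..T. eps i *\<^sub>R x i) - (\<Sum>i=1..<t. x i)"
  have split: "C *\<^sub>R (\<Sum>i=t..T. (eps(t := et)) i *\<^sub>R (x(t := xt)) i) - (\<Sum>i=1..<t. x i)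
      = w + 6 *\<^sub>R (et *\<^sub>R xt)" for et xt
  proof -
    \<comment> \<open>The updates at \<open>t\<close> affect only the first summand, which exists
      because \<open>t \<le> T\<close>; the tail is the sum already contained in
      \<open>w\<close>.\<close>
    have "(\<Sum>i=t..T. (eps(t := et)) i *\<^sub>R (x(t := xt)) i)
        = et *\<^sub>R xt + (\<Sum>i=t+1..T. (eps(t := et)) i *\<^sub>R (x(t := xt)) i)"
      using \<open>t \<in> {1..T}\<close> by (subst sum.atLeast_Suc_atMost) auto
    also have "(\<Sum>i=t+1..T. (eps(t := et)) i *\<^sub>R (x(t := xt)) i) = (\<Sum>i=t+1..T. eps i *\<^sub>R x i)"
      by (intro sum.cong) auto
    finally show ?thesis
      by (simp add: w_def \<open>C = 6\<close> scaleR_add_right)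
  qed
  show ?thesis
    unfolding split w_def[symmetric] expectation_rademacher_times_vertices[of "\<lambda>x. infnorm (w + 6 *\<^sub>R x)"]
    by (intro SUP_least ereal_less_eq(3)[THEN iffD2] integral_infnorm_centred_le)
qed

end
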